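(* Let $\Bbbk$ be a field and $m\ge 0$ an integer. The $\star$-multiplication is a well-defined associative operation on the set of double cosets $\mathbf{P}\backslash \mathrm{GL}(\infty,\Bbbk)/\mathbf{P}$. That is: for $\mathfrak a,\mathfrak p\in \mathrm{GL}(\infty,\Bbbk)$ and any $N$ such that both $\mathfrak a$ and $\mathfrak p$ are $N$-supported, the double coset $$\mathbf{P}\,(\mathfrak a\star_N\mathfrak p)\,\mathbf{P},\qquad \mathfrak a\star_N\mathfrak p=\mathfrak a\,J_N\,\mathfrak p\,J_N,$$ depends only on the double cosets $\mathbf{P}\mathfrak a\mathbf{P}$ and $\mathbf{P}\mathfrak p\mathbf{P}$ (not on the choice of the representatives $\mathfrak a,\mathfrak p$ nor on the choice of $N$), and the resulting binary operation $\star$ on $\mathbf{P}\backslash \mathrm{GL}(\infty,\Bbbk)/\mathbf{P}$ is associative.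
   Context: Let $\Bbbk$ be a field and $m\ge 0$ an integer. Matrices are indexed by the set $I=L\sqcup C\sqcup R$, where $L=\{l_1,l_2,\dots\}$, $C=\{c_1,\dots,c_m\}$, $R=\{r_1,r_2,\dots\}$, ordered as $\dots,l_2,l_1,c_1,\dots,c_m,r_1,r_2,\dots$ (so matrices are infinite to the left, right, up and down, and are regarded as block matrices of size $\infty+m+\infty$). $\mathrm{GL}(\infty,\Bbbk)$ is the group of invertible $I\times I$ matrices $g$ over $\Bbbk$ that are finitary, i.e. $g-1$ has only finitely many nonzero entries. $\mathbf{P}\subset \mathrm{GL}(\infty,\Bbbk)$ is the subgroup of matrices which, in block form with respect to $I=L\sqcup C\sqcup R$, look like $$\begin{pmatrix}\alpha&\varphi&\theta\\ 0&\mathbf 1_m&\psi\\ 0&0&\beta\end{pmatrix},$$ where $\mathbf 1_m$ is the unit matrix of order $m$. $\mathbf{P}\backslash \mathrm{GL}(\infty,\Bbbk)/\mathbf{P}$ denotes the set of double cosets $\mathbf{P}g\mathbf{P}$. For an integer $N\ge 0$, an element $g\in \mathrm{GL}(\infty,\Bbbk)$ is called $N$-supported if all entries of $g-1$ outside the rows and columns indexed by $\{l_1,\dots,l_N\}\cup C\cup\{r_1,\dots,r_N\}$ vanish (that is, $(g-1)_{ij}\neq 0$ implies that both $i$ and $j$ lie in this finite set). Every element is $N$-supported for all sufficiently large $N$. $J_N\in \mathrm{GL}(\infty,\Bbbk)$ is the permutation matrix of the involution of $I$ that swaps $l_i\leftrightarrow l_{i+N}$ and $r_i\leftrightarrow r_{i+N}$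 for $1\le i\le N$ and fixes all other indices. For $N$-supported $\mathfrak a,\mathfrak p$ set $\mathfrak a\star_N\mathfrak p:=\mathfrak a\,J_N\,\mathfrak p\,J_N$ (ordinary matrix product). The $\star$-product of the double cosets of $\mathfrak a$ and $\mathfrak p$ is the double coset of $\mathfrak a\star_N\mathfrak p$, for $N$ sufficiently large that both are $N$-supported. *)

theory Defs
  imports "HOL-Algebra.Coset" "HOL-Library.Groups_Big_Fun"
begin

(* Lft k, Ctr k, Rgt k stand for l_(k+1), c_(k+1), r_(k+1).  Since m may be 0, the finite block
   C is carved out by the carrier index_set m rather than by a (necessarily nonempty) finite
   type; matrices over index_set m are functions that vanish outside index_set m in both
   arguments.  The order of the indices plays no role in any of the definitions. *)

datatype idx = Lft nat | Ctr nat | Rgt nat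

type_synonym 'k imat = "idx \<Rightarrow> idx \<Rightarrow> 'k"

definition L_set :: "idx set" where
  "L_set = range Lft"

definition C_set :: "nat \<Rightarrow> idx set" where
  "C_set m = Ctr ` {..<m}"

definition R_set :: "idx set" where
  "R_set = range Rgt"

definition index_set :: "nat \<Rightarrow> idx set" where
  "index_set m = L_set \<union> C_set m \<union> R_set"

definition matrices :: "nat \<Rightarrow> 'k::field imat set" where
  "matrices m = {A. \<forall>i j. A i j \<noteq> 0 \<longrightarrow> i \<in> index_set m \<and> j \<in> index_set m}"

definition unit_imat :: "nat \<Rightarrow> 'k::field imat" where
  "unit_imat m = (\<lambda>i j. if i = j \<and> i \<in> index_set m then 1 else 0)"

(* Sum_any sums the nonzero terms.  There are only finitely many of them in each entry of the
   product as soon as one of the two factors is finitary, which is the only case used. *)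

definition imat_mult :: "'k::field imat \<Rightarrow> 'k imat \<Rightarrow> 'k imat" where
  "imat_mult A B = (\<lambda>i j. Sum_any (\<lambda>k. A i k * B k j))"

definition finitary :: "nat \<Rightarrow> 'k::field imat \<Rightarrow> bool" where
  "finitary m g \<longleftrightarrow> finite {(i, j). g i j - unit_imat m i j \<noteq> 0}"

definition invertible_imat :: "nat \<Rightarrow> 'k::field imat \<Rightarrow> bool" where
  "invertible_imat m g \<longleftrightarrow>
     (\<exists>h \<in> matrices m. imat_mult g h = unit_imat m \<and> imat_mult h g = unit_imat m)"

definition GL_inf :: "nat \<Rightarrow> 'k::field imat monoid" where
  "GL_inf m = \<lparr>carrier = {g \<in> matrices m. finitary m g \<and> invertible_imat m g},
               mult = imat_mult, one = unit_imat m\<rparr>"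

(* The blocks (C,L), (R,L), (R,C) vanish and the block (C,C) is the unit matrix. *)

definition P_sub :: "nat \<Rightarrow> 'k::field imat set" where
  "P_sub m = {g \<in> carrier (GL_inf m).
     (\<forall>i \<in> C_set m. \<forall>j \<in> L_set. g i j = 0) \<and>
     (\<forall>i \<in> R_set. \<forall>j \<in> L_set. g i j = 0) \<and>
     (\<forall>i \<in> R_set. \<forall>j \<in> C_set m. g i j = 0) \<and>
     (\<forall>i \<in> C_set m. \<forall>j \<in> C_set m. g i j = (if i = j then 1 else 0))}"

definition double_coset :: "nat \<Rightarrow> 'k::field imat \<Rightarrow> 'k imat set" where
  "double_coset m g = (P_sub m #>\<^bsub>GL_inf m\<^esub> g) <#>\<^bsub>GL_inf m\<^esub> P_sub m"

definition double_cosets :: "nat \<Rightarrow> 'k::field imat set set" where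
  "double_cosets m = double_coset m ` carrier (GL_inf m)"

definition window :: "nat \<Rightarrow> nat \<Rightarrow> idx set" where
  "window m N = Lft ` {..<N} \<union> C_set m \<union> Rgt ` {..<N}"

definition supported :: "nat \<Rightarrow> nat \<Rightarrow> 'k::field imat \<Rightarrow> bool" where
  "supported m N g \<longleftrightarrow>
     (\<forall>i j. g i j - unit_imat m i j \<noteq> 0 \<longrightarrow> i \<in> window m N \<and> j \<in> window m N)"

definition block_swap :: "nat \<Rightarrow> nat \<Rightarrow> nat" where
  "block_swap N k = (if k < N then k + N else if k < 2 * N then k - N else k)"

fun idx_swap :: "nat \<Rightarrow> idx \<Rightarrow> idx" where
  "idx_swap N (Lft k) = Lft (block_swap N k)"
| "idx_swap N (Ctr k) = Ctr k"
| "idx_swap N (Rgt k) = Rgt (block_swap N k)"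

definition J_mat :: "nat \<Rightarrow> nat \<Rightarrow> 'k::field imat" where
  "J_mat m N = (\<lambda>i j. if i = idx_swap N j \<and> j \<in> index_set m then 1 else 0)"

definition star_N :: "nat \<Rightarrow> nat \<Rightarrow> 'k::field imat \<Rightarrow> 'k imat \<Rightarrow> 'k imat" where
  "star_N m N a p =
     a \<otimes>\<^bsub>GL_inf m\<^esub> J_mat m N \<otimes>\<^bsub>GL_inf m\<^esub> p \<otimes>\<^bsub>GL_inf m\<^esub> J_mat m N"

(* The description determines Z only once the multiplication is known to be well defined. *)

definition star :: "nat \<Rightarrow> 'k::field imat set \<Rightarrow> 'k imat set \<Rightarrow> 'k imat set" where
  "star m X Y = (THE Z. \<exists>a \<in> carrier (GL_inf m). \<exists>p \<in> carrier (GL_inf m). \<exists>N.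
     supported m N a \<and> supported m N p \<and>
     X = double_coset m a \<and> Y = double_coset m p \<and> Z = double_coset m (star_N m N a p))"

end

theory Submission
  imports Defs
begin

text \<open>
  If \<open>a\<close> is supported on \<open>S\<close>, \<open>h \<in> P\<close> is supported on \<open>T\<close>, and \<open>S\<close> and \<open>T\<close> meet
  only inside \<open>C\<close>, then \<open>a h a\<^sup>-\<^sup>1 \<in> P\<close>: both factors coming from \<open>a\<close> act trivially on the part of
  \<open>L\<close> and \<open>R\<close> that \<open>h\<close> moves. Hence elements of \<open>P\<close> between \<open>a\<close> and \<open>J p J\<close> can be pushed to the
  outside, which gives independence of the representatives. Independence of \<open>N\<close> and associativity
  come from permutation matrices in \<open>P\<close>: the products to be compared consist of the same factors
  placed in different disjoint ranges of \<open>L\<close> and \<open>R\<close>, and a block swap that fixes the support of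
  the first factor carries one placement into the other. Equality of two double cosets is always
  shown by mutual membership of the representatives, so only the closure of \<open>P\<close> under products
  is needed, not under inverses.
\<close>

section \<open>Supports and finite windows\<close>

text \<open>Arbitrary sets are allowed because relabelled matrices live on shifted blocks rather
  than on windows, and because conjugation compares two such sets.\<close>

definition supported_on :: "nat \<Rightarrow> idx set \<Rightarrow> 'k::field imat \<Rightarrow> bool" where
  "supported_on m S g \<longleftrightarrow> (\<forall>i j. i \<notin> S \<or> j \<notin> S \<longrightarrow> g i j = unit_imat m i j)"

lemma supported_iff: "supported m N g \<longleftrightarrow> supported_on m (window m N) g"
  by (auto simp: supported_def supported_on_def)

lemma supported_onD: "supported_on m S g \<Longrightarrow> i \<notin> S \<or> j \<notin> S \<Longrightarrow> g i j = unit_imat m i j"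
  by (auto simp: supported_on_def)

lemma supported_on_mono: "supported_on m S g \<Longrightarrow> S \<subseteq> T \<Longrightarrow> supported_on m T g"
  by (auto simp: supported_on_def)

lemma finite_window: "finite (window m N)"
  by (auto simp: window_def C_set_def)

lemma window_subset_index: "window m N \<subseteq> index_set m"
  by (auto simp: window_def index_set_def L_set_def R_set_def)

lemma window_mono: "N \<le> M \<Longrightarrow> window m N \<subseteq> window m M"
  by (auto simp: window_def)

lemma supported_mono: "supported m N g \<Longrightarrow> N \<le> M \<Longrightarrow> supported m M g"
  using supported_on_mono window_mono by (metis supported_iff)

lemma finite_subset_window:
  assumes "finite F" "F \<subseteq> index_set m"
  shows "\<exists>N. F \<subseteq> window m N"
  using assms
proof (induction F rule: finite_induct)
  case (insert x F)
  then obtain N where N: "F \<subseteq> window m N" by auto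
  have "\<exists>M. x \<in> window m M"
  proof (cases x)
    case (Lft k) then show ?thesis by (auto simp: window_def intro: exI[of _ "Suc k"])
  next
    case (Ctr k) then show ?thesis using insert.prems
      by (auto simp: window_def index_set_def L_set_def R_set_def)
  next
    case (Rgt k) then show ?thesis by (auto simp: window_def intro: exI[of _ "Suc k"])
  qed
  then obtain M where "x \<in> window m M" by blast
  then have "insert x F \<subseteq> window m (max M N)"
    using N window_mono[of M "max M N" m] window_mono[of N "max M N" m] by auto
  then show ?case by blast
qed auto

lemma supported_matrices: "supported m N g \<Longrightarrow> g \<in> matrices m"
  using window_subset_index[of m N]
  by (auto simp: supported_def matrices_def unit_imat_def split: if_splits) (metis diff_zero subsetD)+

text \<open>Membership in \<open>matrices\<close> puts the rows and columns of the finitely many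
  nonzero entries of g - 1 inside the index set, and windows exhaust that set.\<close>

lemma ex_supported_iff: "(\<exists>N. supported m N g) \<longleftrightarrow> g \<in> matrices m \<and> finitary m g"
proof
  assume "\<exists>N. supported m N g"
  then obtain N where N: "supported m N g" by blast
  have "{(i, j). g i j - unit_imat m i j \<noteq> 0} \<subseteq> window m N \<times> window m N"
    using N by (auto simp: supported_def)
  then have "finitary m g"
    unfolding finitary_def by (rule finite_subset) (simp add: finite_window)
  with N supported_matrices show "g \<in> matrices m \<and> finitary m g" by blast
next
  assume g: "g \<in> matrices m \<and> finitary m g"
  let ?D = "{(i, j). g i j - unit_imat m i j \<noteq> 0}"
  have fin: "finite (fst ` ?D \<union> snd ` ?D)" using g by (simp add: finitary_def)
  have sub: "fst ` ?D \<union> snd ` ?D \<subseteq> index_set m"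
    using g by (fastforce simp: matrices_def unit_imat_def split: if_splits)
  obtain N where "fst ` ?D \<union> snd ` ?D \<subseteq> window m N" using finite_subset_window[OF fin sub] by blast
  then have "supported m N g" unfolding supported_def by force
  then show "\<exists>N. supported m N g" by blast
qed

section \<open>Matrix multiplication: units, supports, associativity\<close>

lemma unit_matrices: "unit_imat m \<in> matrices m"
  by (auto simp: matrices_def unit_imat_def)

lemma supported_on_unit: "supported_on m S (unit_imat m)"
  by (auto simp: supported_on_def)

text \<open>Only row i of A has to be a unit row, which is what a support gives for i outside it.
  For i outside the index set both sides vanish, by membership of B in
  \<open>matrices\<close>.\<close>

lemma imat_mult_unit_row:
  assumes "\<And>k. A i k = unit_imat m i k" "B \<in> matrices m"
  shows "imat_mult A B i j = B i j"
proof -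
  have "imat_mult A B i j = Sum_any (\<lambda>k. if k = i then B k j else 0)"
    unfolding imat_mult_def using assms
    by (intro Sum_any.cong) (auto simp: unit_imat_def matrices_def)
  then show ?thesis by simp
qed

lemma imat_mult_unit_col:
  assumes "\<And>k. B k j = unit_imat m k j" "A \<in> matrices m"
  shows "imat_mult A B i j = A i j"
proof -
  have "imat_mult A B i j = Sum_any (\<lambda>k. if k = j then A i k else 0)"
    unfolding imat_mult_def using assms
    by (intro Sum_any.cong) (auto simp: unit_imat_def matrices_def)
  then show ?thesis by simp
qed

lemma imat_mult_unit_left: "A \<in> matrices m \<Longrightarrow> imat_mult (unit_imat m) A = A"
  by (intro ext imat_mult_unit_row) auto

lemma imat_mult_unit_right: "A \<in> matrices m \<Longrightarrow> imat_mult A (unit_imat m) = A"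
  by (intro ext imat_mult_unit_col) auto

lemma supported_on_mult:
  assumes "supported_on m S A" "supported_on m S B" "A \<in> matrices m" "B \<in> matrices m"
  shows "supported_on m S (imat_mult A B)"
  unfolding supported_on_def
proof (intro allI impI)
  fix i j assume "i \<notin> S \<or> j \<notin> S"
  then show "imat_mult A B i j = unit_imat m i j"
  proof
    assume "i \<notin> S"
    then show ?thesis using assms imat_mult_unit_row[of A i m B j] by (simp add: supported_on_def)
  next
    assume "j \<notin> S"
    then show ?thesis using assms imat_mult_unit_col[of B j m A i] by (simp add: supported_on_def)
  qed
qed

text \<open>For i outside S, row i of g is a unit row, so row i of h is row i of g h = 1; columns
  are read off from h g = 1.\<close>

lemma supported_on_inverse:
  assumes "supported_on m S g" "h \<in> matrices m"
    and "imat_mult g h = unit_imat m" "imat_mult h g = unit_imat m"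
  shows "supported_on m S h"
  unfolding supported_on_def
proof (intro allI impI)
  fix i j assume "i \<notin> S \<or> j \<notin> S"
  then show "h i j = unit_imat m i j"
  proof
    assume "i \<notin> S"
    then show ?thesis using assms imat_mult_unit_row[of g i m h j] by (simp add: supported_on_def)
  next
    assume "j \<notin> S"
    then show ?thesis using assms imat_mult_unit_col[of g j m h i] by (simp add: supported_on_def)
  qed
qed

text \<open>\<open>Sum_any\<close> is 0 on infinite supports. Finite rows of A and finite columns of
  C turn the sums into finite ones, whose order can be exchanged; B stays arbitrary.\<close>

lemma imat_mult_assoc:
  assumes "\<And>i. finite {k. A i k \<noteq> 0}" "\<And>j. finite {l. C l j \<noteq> 0}"
  shows "imat_mult (imat_mult A B) C = imat_mult A (imat_mult B C)"
proof (intro ext)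
  fix i j
  let ?K = "{k. A i k \<noteq> 0}" and ?L = "{l. C l j \<noteq> 0}"
  have 1: "imat_mult A D i l = (\<Sum>k\<in>?K. A i k * D k l)" for D l
    unfolding imat_mult_def by (rule Sum_any.expand_superset) (auto simp: assms)
  have 2: "imat_mult D C k j = (\<Sum>l\<in>?L. D k l * C l j)" for D k
    unfolding imat_mult_def by (rule Sum_any.expand_superset) (auto simp: assms)
  have "imat_mult (imat_mult A B) C i j = (\<Sum>l\<in>?L. \<Sum>k\<in>?K. A i k * B k l * C l j)"
    by (simp add: 1 2 sum_distrib_right)
  also have "\<dots> = (\<Sum>k\<in>?K. \<Sum>l\<in>?L. A i k * B k l * C l j)"
    by (rule sum.swap)
  also have "\<dots> = imat_mult A (imat_mult B C) i j"
    by (simp add: 1 2 sum_distrib_left mult.assoc)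
  finally show "imat_mult (imat_mult A B) C i j = imat_mult A (imat_mult B C) i j" .
qed

lemma supported_finite_row:
  assumes "supported m N g"
  shows "finite {k. g i k \<noteq> 0}"
proof -
  have "k = i" if "g i k \<noteq> 0" "k \<notin> window m N" for k
    using that assms supported_onD[of m "window m N" g i k]
    by (auto simp: supported_iff unit_imat_def split: if_splits)
  then have "{k. g i k \<noteq> 0} \<subseteq> insert i (window m N)" by blast
  then show ?thesis by (rule finite_subset) (simp add: finite_window)
qed

lemma supported_finite_col:
  assumes "supported m N g"
  shows "finite {k. g k j \<noteq> 0}"
proof -
  have "k = j" if "g k j \<noteq> 0" "k \<notin> window m N" for k
    using that assms supported_onD[of m "window m N" g k j]
    by (auto simp: supported_iff unit_imat_def split: if_splits)
  then have "{k. g k j \<noteq> 0} \<subseteq> insert j (window m N)" by blast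
  then show ?thesis by (rule finite_subset) (simp add: finite_window)
qed

section \<open>Group laws for finitary invertible matrices\<close>

lemma carrier_GL_iff:
  "g \<in> carrier (GL_inf m) \<longleftrightarrow> (\<exists>N. supported m N g) \<and> invertible_imat m g"
  by (auto simp: GL_inf_def ex_supported_iff)

lemma carrier_matrices: "g \<in> carrier (GL_inf m) \<Longrightarrow> g \<in> matrices m"
  by (auto simp: GL_inf_def)

lemma carrier_supported: "g \<in> carrier (GL_inf m) \<Longrightarrow> \<exists>N. supported m N g"
  by (auto simp: carrier_GL_iff)

lemma mult_GL [simp]: "mult (GL_inf m) = imat_mult"
  by (simp add: GL_inf_def)

lemma carrier_assoc:
  assumes "a \<in> carrier (GL_inf m)" "c \<in> carrier (GL_inf m)"
  shows "imat_mult (imat_mult a b) c = imat_mult a (imat_mult b c)"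
  using carrier_supported[OF assms(1)] carrier_supported[OF assms(2)]
  by (auto intro!: imat_mult_assoc dest: supported_finite_row supported_finite_col)

lemma carrier_mult:
  assumes a: "a \<in> carrier (GL_inf m)" and b: "b \<in> carrier (GL_inf m)"
  shows "imat_mult a b \<in> carrier (GL_inf m)"
proof -
  obtain N where N: "supported m N a" "supported m N b"
    using a b carrier_supported supported_mono by (metis nle_le)
  have s: "supported m N (imat_mult a b)"
    using N a b carrier_matrices supported_on_mult by (metis supported_iff)
  obtain a' where a': "a' \<in> matrices m" "imat_mult a a' = unit_imat m" "imat_mult a' a = unit_imat m"
    using a by (auto simp: carrier_GL_iff invertible_imat_def)
  obtain b' where b': "b' \<in> matrices m" "imat_mult b b' = unit_imat m" "imat_mult b' b = unit_imat m"
    using b by (auto simp: carrier_GL_iff invertible_imat_def)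
  \<comment> \<open>\<open>invertible_imat\<close> says nothing about the support of an inverse; the
    window found here supplies the finiteness that associativity needs.\<close>
  have s': "supported m N a'" "supported m N b'"
    using supported_on_inverse a' b' N by (metis supported_iff)+
  note fr = supported_finite_row[OF N(1)] supported_finite_row[OF N(2)]
    supported_finite_row[OF s'(1)] supported_finite_row[OF s'(2)]
    supported_finite_row[OF s]
  note fc = supported_finite_col[OF N(1)] supported_finite_col[OF N(2)]
    supported_finite_col[OF s'(1)] supported_finite_col[OF s'(2)]
    supported_finite_col[OF s]
  have "imat_mult (imat_mult a b) (imat_mult b' a') = imat_mult (imat_mult (imat_mult a b) b') a'"
    by (rule imat_mult_assoc[symmetric]) (rule fr fc)+
  also have "\<dots> = unit_imat m"
    using a' b' carrier_matrices[OF a] by (simp add: imat_mult_assoc fr fc imat_mult_unit_right)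
  finally have 1: "imat_mult (imat_mult a b) (imat_mult b' a') = unit_imat m" .
  have "imat_mult (imat_mult b' a') (imat_mult a b) = imat_mult b' (imat_mult a' (imat_mult a b))"
    by (rule imat_mult_assoc) (rule fr fc)+
  also have "imat_mult a' (imat_mult a b) = imat_mult (imat_mult a' a) b"
    by (rule imat_mult_assoc[symmetric]) (rule fr fc)+
  finally have 2: "imat_mult (imat_mult b' a') (imat_mult a b) = unit_imat m"
    using a' b' carrier_matrices[OF b] by (simp add: imat_mult_unit_left)
  have "supported m N (imat_mult b' a')"
    using s' a' b' supported_on_mult by (metis supported_iff)
  then have "imat_mult b' a' \<in> matrices m" by (rule supported_matrices)
  with 1 2 s show ?thesis by (auto simp: carrier_GL_iff invertible_imat_def)
qed

lemma carrier_inverse: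
  assumes a: "a \<in> carrier (GL_inf m)"
  obtains b where "b \<in> carrier (GL_inf m)" "imat_mult a b = unit_imat m"
    "imat_mult b a = unit_imat m" "\<And>S. supported_on m S a \<Longrightarrow> supported_on m S b"
proof -
  obtain b where b: "b \<in> matrices m" "imat_mult a b = unit_imat m" "imat_mult b a = unit_imat m"
    using a by (auto simp: carrier_GL_iff invertible_imat_def)
  have S: "supported_on m S a \<Longrightarrow> supported_on m S b" for S
    using supported_on_inverse b by blast
  have "b \<in> carrier (GL_inf m)"
    unfolding carrier_GL_iff invertible_imat_def
    using carrier_supported[OF a] carrier_matrices[OF a] S b supported_iff by blast
  with b S that show ?thesis by blast
qed

lemma carrier_unit: "unit_imat m \<in> carrier (GL_inf m)"
  by (auto simp: carrier_GL_iff invertible_imat_def supported_iff supported_on_unit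
      imat_mult_unit_left unit_matrices intro!: bexI[of _ "unit_imat m"])

subsection \<open>The subgroup P\<close>

lemma not_L_iff: "i \<in> index_set m \<Longrightarrow> i \<notin> L_set \<longleftrightarrow> i \<in> C_set m \<or> i \<in> R_set"
  by (auto simp: index_set_def L_set_def C_set_def R_set_def)

lemma not_R_iff: "i \<in> index_set m \<Longrightarrow> i \<notin> R_set \<longleftrightarrow> i \<in> C_set m \<or> i \<in> L_set"
  by (auto simp: index_set_def L_set_def C_set_def R_set_def)

text \<open>Rows outside L and columns outside R meet in the blocks (C,L), (C,C), (R,L), (R,C),
  where the unit matrix has the prescribed entries; outside the index set both sides are 0.\<close>

lemma P_sub_iff:
  "g \<in> P_sub m \<longleftrightarrow> g \<in> carrier (GL_inf m) \<and>
    (\<forall>i j. i \<notin> L_set \<longrightarrow> j \<notin> R_set \<longrightarrow> g i j = unit_imat m i j)"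
proof
  assume g: "g \<in> P_sub m"
  then have gc: "g \<in> carrier (GL_inf m)" by (simp add: P_sub_def)
  {
    fix i j assume ij: "i \<notin> L_set" "j \<notin> R_set"
    have "g i j = unit_imat m i j"
    proof (cases "i \<in> index_set m \<and> j \<in> index_set m")
      case True
      then show ?thesis using ij g not_L_iff[of i m] not_R_iff[of j m]
        by (auto simp: P_sub_def unit_imat_def)
    next
      case False
      then show ?thesis using carrier_matrices[OF gc]
        by (auto simp: matrices_def unit_imat_def)
    qed
  }
  with gc show "g \<in> carrier (GL_inf m) \<and>
    (\<forall>i j. i \<notin> L_set \<longrightarrow> j \<notin> R_set \<longrightarrow> g i j = unit_imat m i j)" by blast
next
  assume g: "g \<in> carrier (GL_inf m) \<and>
    (\<forall>i j. i \<notin> L_set \<longrightarrow> j \<notin> R_set \<longrightarrow> g i j = unit_imat m i j)"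
  then show "g \<in> P_sub m"
    by (auto simp: P_sub_def L_set_def C_set_def R_set_def unit_imat_def index_set_def image_iff)
qed

lemma P_sub_carrier: "g \<in> P_sub m \<Longrightarrow> g \<in> carrier (GL_inf m)"
  by (simp add: P_sub_def)

lemma P_sub_entry: "g \<in> P_sub m \<Longrightarrow> i \<notin> L_set \<Longrightarrow> j \<notin> R_set \<Longrightarrow> g i j = unit_imat m i j"
  by (simp add: P_sub_iff)

lemma P_sub_unit: "unit_imat m \<in> P_sub m"
  by (simp add: P_sub_iff carrier_unit)

lemma LR_disjoint: "k \<in> L_set \<Longrightarrow> k \<notin> R_set"
  by (auto simp: L_set_def R_set_def)

text \<open>Each summand agrees with that of the squared unit matrix: for k in L the factor g i k is
  0 because i is not in L, for k in R the factor h k j is 0 because j is not in R, and otherwise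
  both factors are unit entries.\<close>

lemma P_sub_mult:
  assumes g: "g \<in> P_sub m" and h: "h \<in> P_sub m"
  shows "imat_mult g h \<in> P_sub m"
  unfolding P_sub_iff
proof (intro conjI allI impI)
  show "imat_mult g h \<in> carrier (GL_inf m)" using assms by (simp add: carrier_mult P_sub_carrier)
  fix i j assume ij: "i \<notin> L_set" "j \<notin> R_set"
  have "g i k * h k j = unit_imat m i k * unit_imat m k j" for k
  proof (cases "k \<in> L_set")
    case True
    then have "g i k = 0" "unit_imat m i k = (0::'a)"
      using P_sub_entry[OF g ij(1), of k] ij LR_disjoint[OF True] by (auto simp: unit_imat_def)
    then show ?thesis by simp
  next
    case False
    then have hk: "h k j = unit_imat m k j" using P_sub_entry[OF h _ ij(2)] by blast
    show ?thesis
    proof (cases "k \<in> R_set")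
      case True
      then show ?thesis using hk ij by (auto simp: unit_imat_def)
    next
      case False
      then show ?thesis using hk P_sub_entry[OF g ij(1)] by simp
    qed
  qed
  then have "imat_mult g h i j = imat_mult (unit_imat m) (unit_imat m) i j"
    unfolding imat_mult_def by simp
  then show "imat_mult g h i j = unit_imat m i j"
    by (simp add: imat_mult_unit_left unit_matrices)
qed

text \<open>The inverse b is a parameter with its own support, so that conjugation in either order
  is covered.\<close>

lemma P_sub_conj:
  assumes a: "a \<in> carrier (GL_inf m)" "supported_on m S a"
    and b: "b \<in> carrier (GL_inf m)" "supported_on m S b" "imat_mult a b = unit_imat m"
    and h: "h \<in> P_sub m" "supported_on m T h"
    and ST: "S \<inter> T \<subseteq> C_set m"
  shows "imat_mult (imat_mult a h) b \<in> P_sub m"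
  unfolding P_sub_iff
proof (intro conjI allI impI)
  show "imat_mult (imat_mult a h) b \<in> carrier (GL_inf m)"
    using assms by (simp add: carrier_mult P_sub_carrier)
  fix i j assume ij: "i \<notin> L_set" "j \<notin> R_set"
  have CLR: "C_set m \<inter> L_set = {}" "C_set m \<inter> R_set = {}"
    by (auto simp: C_set_def L_set_def R_set_def)
  \<comment> \<open>A non-unit entry h k l forces k and l into T. If l were in R, it would differ
    from j, so b l j would put l in S, against S and T meeting inside C. Hence k is in L, and a i k
    leads to the same contradiction. So h can be replaced by 1.\<close>
  have ahb: "a i k * h k l = a i k * unit_imat m k l" if "b l j \<noteq> 0" for k l
  proof (rule ccontr)
    assume "\<not> ?thesis"
    then have ne: "a i k \<noteq> 0" "h k l \<noteq> unit_imat m k l" by auto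
    then have T: "k \<in> T" "l \<in> T" using h by (auto simp: supported_on_def)
    have "l \<notin> R_set"
    proof
      assume l: "l \<in> R_set"
      then have "l \<noteq> j" using ij by auto
      then have "l \<in> S" using that supported_onD[OF b(2), of l j] by (auto simp: unit_imat_def)
      then show False using T ST CLR l by blast
    qed
    then have k: "k \<in> L_set" using ne P_sub_entry[OF h(1)] by blast
    then have "k \<noteq> i" using ij by auto
    then have "k \<in> S" using ne supported_onD[OF a(2), of i k] by (auto simp: unit_imat_def)
    then show False using T ST CLR k by blast
  qed
  have "imat_mult (imat_mult a h) b i j = imat_mult (imat_mult a (unit_imat m)) b i j"
  proof -
    have "imat_mult a h i l * b l j = imat_mult a (unit_imat m) i l * b l j" for l
      by (cases "b l j = 0") (simp_all add: imat_mult_def ahb)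
    then show ?thesis unfolding imat_mult_def[of _ b] by (intro Sum_any.cong)
  qed
  then show "imat_mult (imat_mult a h) b i j = unit_imat m i j"
    using a b by (simp add: imat_mult_unit_right carrier_matrices)
qed

section \<open>Double cosets\<close>

lemma double_coset_eq:
  "double_coset m g = {imat_mult (imat_mult h g) k |h k. h \<in> P_sub m \<and> k \<in> P_sub m}"
  by (auto simp: double_coset_def r_coset_def set_mult_def)

lemma double_cosetI:
  "h \<in> P_sub m \<Longrightarrow> k \<in> P_sub m \<Longrightarrow> imat_mult (imat_mult h g) k \<in> double_coset m g"
  by (auto simp: double_coset_eq)

lemma double_coset_self: "g \<in> carrier (GL_inf m) \<Longrightarrow> g \<in> double_coset m g"
  using double_cosetI[OF P_sub_unit P_sub_unit, of m g]
  by (simp add: carrier_matrices imat_mult_unit_left imat_mult_unit_right)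

lemma double_coset_trans:
  assumes "x \<in> double_coset m y" "y \<in> double_coset m z" "z \<in> carrier (GL_inf m)"
  shows "x \<in> double_coset m z"
proof -
  obtain h k where hk: "h \<in> P_sub m" "k \<in> P_sub m" "x = imat_mult (imat_mult h y) k"
    using assms by (auto simp: double_coset_eq)
  obtain h' k' where hk': "h' \<in> P_sub m" "k' \<in> P_sub m" "y = imat_mult (imat_mult h' z) k'"
    using assms by (auto simp: double_coset_eq)
  have "x = imat_mult (imat_mult (imat_mult h h') z) (imat_mult k' k)"
    using hk hk' assms(3) by (simp add: carrier_assoc[of _ m] carrier_mult P_sub_carrier)
  then show ?thesis using hk hk' by (auto intro!: double_cosetI P_sub_mult)
qed

lemma double_coset_eqI:
  assumes "x \<in> double_coset m y" "y \<in> double_coset m x"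
    "x \<in> carrier (GL_inf m)" "y \<in> carrier (GL_inf m)"
  shows "double_coset m x = double_coset m y"
  using assms double_coset_trans by blast

subsection \<open>Relabelling of indices\<close>

primrec idx_map :: "(nat \<Rightarrow> nat) \<Rightarrow> idx \<Rightarrow> idx" where
  "idx_map f (Lft k) = Lft (f k)"
| "idx_map f (Ctr k) = Ctr k"
| "idx_map f (Rgt k) = Rgt (f k)"

text \<open>An involution makes the permutation matrix its own inverse; finiteness keeps that matrix
  finitary.\<close>

definition finite_involution :: "(nat \<Rightarrow> nat) \<Rightarrow> bool" where
  "finite_involution f \<longleftrightarrow> (\<forall>k. f (f k) = k) \<and> finite {k. f k \<noteq> k}"

text \<open>Allowed for every f, since compositions of two involutions, which need not be
  involutions, also occur.\<close>

definition relabel :: "(nat \<Rightarrow> nat) \<Rightarrow> 'k::field imat \<Rightarrow> 'k imat" where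
  "relabel f g = (\<lambda>i j. g (idx_map f i) (idx_map f j))"

definition perm_mat :: "nat \<Rightarrow> (nat \<Rightarrow> nat) \<Rightarrow> 'k::field imat" where
  "perm_mat m f = (\<lambda>i j. if i = idx_map f j \<and> j \<in> index_set m then 1 else 0)"

text \<open>Extends \<open>block_swap\<close>, the case A = 0, B = N, to a family that moves blocks
  to other places.\<close>

definition range_swap :: "nat \<Rightarrow> nat \<Rightarrow> nat \<Rightarrow> nat \<Rightarrow> nat" where
  "range_swap N A B k =
    (if A \<le> k \<and> k < A + N then k - A + B else if B \<le> k \<and> k < B + N then k - B + A else k)"

lemma idx_swap_eq: "idx_swap N = idx_map (range_swap N 0 N)"
proof
  fix i show "idx_swap N i = idx_map (range_swap N 0 N) i"
    by (cases i) (auto simp: block_swap_def range_swap_def)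
qed

lemma J_mat_eq: "J_mat m N = perm_mat m (range_swap N 0 N)"
  by (simp add: J_mat_def perm_mat_def idx_swap_eq)

lemma finite_involution_range_swap:
  assumes "A + N \<le> B"
  shows "finite_involution (range_swap N A B)"
proof -
  have "{k. range_swap N A B k \<noteq> k} \<subseteq> {..<B + N}"
    using assms by (auto simp: range_swap_def split: if_splits)
  then have "finite {k. range_swap N A B k \<noteq> k}"
    using finite_subset by blast
  then show ?thesis using assms by (auto simp: finite_involution_def range_swap_def)
qed

lemma idx_map_index [simp]: "idx_map f i \<in> index_set m \<longleftrightarrow> i \<in> index_set m"
  by (cases i) (auto simp: index_set_def L_set_def C_set_def R_set_def)

lemma idx_map_involution: "finite_involution f \<Longrightarrow> idx_map f (idx_map f i) = i"
  by (cases i) (auto simp: finite_involution_def)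

lemma idx_map_eq_iff: "finite_involution f \<Longrightarrow> idx_map f i = idx_map f j \<longleftrightarrow> i = j"
  using idx_map_involution by metis

lemma relabel_involution: "finite_involution f \<Longrightarrow> relabel f (relabel f g) = g"
  by (simp add: relabel_def idx_map_involution)

lemma mult_perm_right:
  assumes "A \<in> matrices m"
  shows "imat_mult A (perm_mat m f) i j = A i (idx_map f j)"
proof -
  have "A i (idx_map f j) = 0" if "j \<notin> index_set m"
    using assms that idx_map_index[of f j m] unfolding matrices_def by blast
  then have "imat_mult A (perm_mat m f) i j = Sum_any (\<lambda>k. if k = idx_map f j then A i k else 0)"
    unfolding imat_mult_def
    by (intro Sum_any.cong) (auto simp: perm_mat_def)
  then show ?thesis by simp
qed

lemma mult_perm_left:
  assumes "A \<in> matrices m" "finite_involution f"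
  shows "imat_mult (perm_mat m f) A i j = A (idx_map f i) j"
proof -
  have "imat_mult (perm_mat m f) A i j = Sum_any (\<lambda>k. if k = idx_map f i then A k j else 0)"
    unfolding imat_mult_def using assms
    by (intro Sum_any.cong) (auto simp: perm_mat_def matrices_def idx_map_involution)
  then show ?thesis by simp
qed

lemma perm_mat_matrices: "perm_mat m f \<in> matrices m"
  by (auto simp: matrices_def perm_mat_def)

lemma perm_mat_square: "finite_involution f \<Longrightarrow> imat_mult (perm_mat m f) (perm_mat m f) = unit_imat m"
  by (auto intro!: ext simp: mult_perm_right perm_mat_matrices)
    (auto simp: perm_mat_def unit_imat_def idx_map_involution)

lemma perm_mat_carrier:
  assumes f: "finite_involution f"
  shows "perm_mat m f \<in> carrier (GL_inf m)"
proof -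
  let ?M = "Lft ` {k. f k \<noteq> k} \<union> Rgt ` {k. f k \<noteq> k}"
  have fixed: "idx_map f i = i" if "i \<notin> ?M" for i
    using that by (cases i) auto
  have "finite ?M" "?M \<subseteq> index_set m"
    using f by (simp_all add: finite_involution_def index_set_def L_set_def R_set_def image_subset_iff)
  then obtain N where N: "?M \<subseteq> window m N" using finite_subset_window by blast
  have "supported_on m ?M (perm_mat m f)"
    unfolding supported_on_def
  proof (intro allI impI)
    fix i j assume "i \<notin> ?M \<or> j \<notin> ?M"
    then have "idx_map f i = i \<or> idx_map f j = j" using fixed[of i] fixed[of j] by argo
    then have "i = idx_map f j \<longleftrightarrow> i = j" using idx_map_eq_iff[OF f, of i j] by auto
    then show "perm_mat m f i j = unit_imat m i j"
      by (auto simp: perm_mat_def unit_imat_def)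
  qed
  then have "supported m N (perm_mat m f)"
    using supported_on_mono[OF _ N] by (simp add: supported_iff)
  then show ?thesis
    unfolding carrier_GL_iff invertible_imat_def
    using perm_mat_square[OF f, of m] perm_mat_matrices[of m f] by blast
qed

text \<open>\<open>idx_map\<close> preserves L and R and fixes C pointwise, so the matrix is block
  diagonal with unit middle block.\<close>

lemma perm_mat_P_sub:
  assumes f: "finite_involution f"
  shows "(perm_mat m f :: 'k::field imat) \<in> P_sub m"
proof -
  have "(perm_mat m f :: 'k imat) i j = unit_imat m i j" if "i \<notin> L_set" "j \<notin> R_set" for i j
  proof (cases "i = idx_map f j")
    case True
    then show ?thesis using that
      by (cases j) (auto simp: L_set_def R_set_def perm_mat_def unit_imat_def)
  next
    case False
    then show ?thesis using that
      by (cases j) (auto simp: L_set_def R_set_def perm_mat_def unit_imat_def)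
  qed
  then show ?thesis by (simp add: P_sub_iff perm_mat_carrier[OF f])
qed

lemma relabel_conj:
  assumes "A \<in> carrier (GL_inf m)" "finite_involution f"
  shows "relabel f A = imat_mult (imat_mult (perm_mat m f) A) (perm_mat m f)"
proof (intro ext)
  fix i j
  have "imat_mult (perm_mat m f) A \<in> carrier (GL_inf m)"
    using assms by (simp add: carrier_mult perm_mat_carrier)
  then show "relabel f A i j = imat_mult (imat_mult (perm_mat m f) A) (perm_mat m f) i j"
    using assms by (simp add: mult_perm_right mult_perm_left carrier_matrices relabel_def)
qed

lemma relabel_carrier: "A \<in> carrier (GL_inf m) \<Longrightarrow> finite_involution f \<Longrightarrow> relabel f A \<in> carrier (GL_inf m)"
  by (simp add: relabel_conj carrier_mult perm_mat_carrier)

lemma relabel_P_sub: "A \<in> P_sub m \<Longrightarrow> finite_involution f \<Longrightarrow> relabel f A \<in> P_sub m"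
  by (simp add: relabel_conj[OF P_sub_carrier] P_sub_mult perm_mat_P_sub)

text \<open>Relabelling is conjugation by an element of P; the converse membership holds because
  relabelling twice gives back A.\<close>

lemma double_coset_relabel:
  assumes A: "A \<in> carrier (GL_inf m)" and f: "finite_involution f"
  shows "double_coset m (relabel f A) = double_coset m A"
proof -
  have in_dc: "relabel f B \<in> double_coset m B" if "B \<in> carrier (GL_inf m)" for B :: "'a imat"
    using that f by (simp add: relabel_conj double_cosetI perm_mat_P_sub)
  show ?thesis
    using in_dc[OF A] in_dc[OF relabel_carrier[OF A f]] A relabel_carrier[OF A f]
    by (intro double_coset_eqI) (simp_all add: relabel_involution[OF f])
qed

lemma relabel_mult:
  fixes A B :: "'k::field imat"
  assumes A: "A \<in> carrier (GL_inf m)" and B: "B \<in> carrier (GL_inf m)" and f: "finite_involution f"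
  shows "relabel f (imat_mult A B) = imat_mult (relabel f A) (relabel f B)"
proof -
  let ?J = "perm_mat m f :: 'k imat"
  have J: "?J \<in> carrier (GL_inf m)" using f by (rule perm_mat_carrier)
  note c = A B J
  have "imat_mult ?J (imat_mult ?J X) = X" if "X \<in> carrier (GL_inf m)" for X
    using that c perm_mat_square[OF f, of m]
    by (metis carrier_assoc carrier_matrices imat_mult_unit_left)
  then show ?thesis using c f
    by (simp add: relabel_conj[of _ m] carrier_mult carrier_assoc[of _ m])
qed

lemma relabel_supported_on:
  assumes "supported_on m S g" "finite_involution f"
  shows "supported_on m (idx_map f -` S) (relabel f g)"
  unfolding supported_on_def
proof (intro allI impI)
  fix i j assume "i \<notin> idx_map f -` S \<or> j \<notin> idx_map f -` S"
  then have "relabel f g i j = unit_imat m (idx_map f i) (idx_map f j)"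
    using supported_onD[OF assms(1), of "idx_map f i" "idx_map f j"] by (simp add: relabel_def)
  then show "relabel f g i j = unit_imat m i j"
    using assms(2) by (simp add: unit_imat_def idx_map_eq_iff)
qed

text \<open>Relabelling is precomposition, hence the reversed order.\<close>

lemma relabel_comp: "relabel f (relabel g p) = relabel (g \<circ> f) p"
proof -
  have "idx_map g (idx_map f i) = idx_map (g \<circ> f) i" for i
    by (cases i) auto
  then show ?thesis by (simp add: relabel_def)
qed

text \<open>Where u and v both land outside the support, p has unit entries, and injectivity
  preserves these. So relabellings may differ as functions away from the block that p comes to
  occupy.\<close>

lemma relabel_cong:
  assumes p: "supported m N p" and inj: "inj u" "inj v"
    and uv: "\<And>k. u k < N \<or> v k < N \<Longrightarrow> u k = v k"
  shows "relabel u p = relabel v p"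
proof (intro ext)
  fix i j
  have eq: "idx_map u x = idx_map v x" if "idx_map u x \<in> window m N \<or> idx_map v x \<in> window m N" for x
    using that uv by (cases x) (auto simp: window_def C_set_def)
  have out: "relabel w p i j = unit_imat m i j"
    if "inj w" "idx_map w i \<notin> window m N \<or> idx_map w j \<notin> window m N" for w
  proof -
    have "idx_map w i = idx_map w j \<longleftrightarrow> i = j"
      using injD[OF that(1)] by (cases i; cases j) auto
    then show ?thesis
      using that(2) p supported_onD[of m "window m N" p "idx_map w i" "idx_map w j"]
      by (simp add: supported_iff relabel_def unit_imat_def)
  qed
  show "relabel u p i j = relabel v p i j"
  proof (cases "idx_map u i \<in> window m N \<and> idx_map u j \<in> window m N")
    case True
    then show ?thesis using eq[of i] eq[of j] by (simp add: relabel_def)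
  next
    case False
    then have "idx_map v i \<notin> window m N \<or> idx_map v j \<notin> window m N" using eq by metis
    with False show ?thesis using out inj by metis
  qed
qed

lemma finite_involution_inj: "finite_involution f \<Longrightarrow> inj f"
  by (metis finite_involution_def injI)

lemma relabel_fixes:
  assumes "supported m N p" "finite_involution f" "\<And>k. k < N \<Longrightarrow> f k = k"
  shows "relabel f p = p"
proof -
  \<comment> \<open>The hypothesis applied to f k gives f (f k) = f k, that is k = f k.\<close>
  have "f k = k" if "f k < N" for k
    using that assms(2,3) unfolding finite_involution_def by metis
  then have "relabel f p = relabel id p"
    using assms by (intro relabel_cong) (auto simp: finite_involution_inj)
  moreover have "idx_map id i = i" for i by (cases i) auto
  ultimately show ?thesis by (simp add: relabel_def)
qed

subsection \<open>The product of double cosets\<close>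

abbreviation swap0 :: "nat \<Rightarrow> nat \<Rightarrow> nat" where
  "swap0 N \<equiv> range_swap N 0 N"

lemma finite_involution_swap0: "finite_involution (swap0 N)"
  by (simp add: finite_involution_range_swap)

text \<open>Conjugation by \<open>J_mat\<close> is a relabelling. For N-supported p the second
  factor lives on C and the blocks starting at N.\<close>

lemma star_N_eq:
  fixes a p :: "'k::field imat"
  assumes "a \<in> carrier (GL_inf m)" "p \<in> carrier (GL_inf m)"
  shows "star_N m N a p = imat_mult a (relabel (swap0 N) p)"
proof -
  have "(perm_mat m (swap0 N) :: 'k imat) \<in> carrier (GL_inf m)"
    using finite_involution_swap0 by (rule perm_mat_carrier)
  with assms show ?thesis
    by (simp add: star_N_def J_mat_eq relabel_conj[of _ m] finite_involution_swap0
        carrier_assoc[of _ m] carrier_mult)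
qed

lemma star_N_carrier:
  "a \<in> carrier (GL_inf m) \<Longrightarrow> p \<in> carrier (GL_inf m) \<Longrightarrow> star_N m N a p \<in> carrier (GL_inf m)"
  by (simp add: star_N_eq carrier_mult relabel_carrier finite_involution_swap0)

lemma supported_relabel_swap0:
  assumes "supported m N p" "2 * N \<le> M"
  shows "supported m M (relabel (swap0 N) p)"
proof -
  have "idx_map (swap0 N) -` window m N \<subseteq> window m M"
  proof
    fix i assume "i \<in> idx_map (swap0 N) -` window m N"
    then show "i \<in> window m M" using assms(2)
      by (cases i) (auto simp: window_def C_set_def range_swap_def split: if_splits)
  qed
  then show ?thesis
    using relabel_supported_on[OF _ finite_involution_swap0] assms(1) supported_on_mono
    by (metis supported_iff)
qed

lemma supported_star_N:
  assumes "a \<in> carrier (GL_inf m)" "p \<in> carrier (GL_inf m)"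
    "supported m N a" "supported m N p" "2 * N \<le> M"
  shows "supported m M (star_N m N a p)"
proof -
  have "supported m M a" using assms supported_mono[of m N a M] by simp
  then show ?thesis
    using assms supported_relabel_swap0[of m N p M]
    by (simp add: star_N_eq supported_iff supported_on_mult carrier_matrices relabel_carrier
        finite_involution_swap0)
qed

text \<open>Swapping the block starting at N with the one starting at M fixes a and carries the
  shifted copy of p to its new place; M >= 2 N keeps the two blocks disjoint.\<close>

lemma star_N_far:
  assumes a: "a \<in> carrier (GL_inf m)" "supported m N a"
    and p: "p \<in> carrier (GL_inf m)" "supported m N p"
    and M: "2 * N \<le> M"
  shows "double_coset m (star_N m N a p) = double_coset m (star_N m M a p)"
proof -
  let ?f = "range_swap N N M"
  have f: "finite_involution ?f" using M by (intro finite_involution_range_swap) auto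
  have a': "relabel ?f a = a"
    by (rule relabel_fixes[OF a(2) f]) (use M in \<open>auto simp: range_swap_def\<close>)
  \<comment> \<open>Both relabellings send k to k - M for M <= k < M + N and take no other k below
    N; elsewhere they may differ.\<close>
  have p': "relabel ?f (relabel (swap0 N) p) = relabel (swap0 M) p"
    unfolding relabel_comp
    by (rule relabel_cong[OF p(2)])
      (use M in \<open>auto simp: range_swap_def f finite_involution_inj finite_involution_swap0
        intro!: inj_compose split: if_splits\<close>)
  have eq: "relabel ?f (star_N m N a p) = star_N m M a p"
    using a p f a' p' by (simp add: star_N_eq relabel_mult relabel_carrier finite_involution_swap0)
  show ?thesis
    using double_coset_relabel[OF star_N_carrier[OF a(1) p(1)] f, of N] by (simp add: eq)
qed

section \<open>Independence of the representatives and of N\<close>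

text \<open>The inner factors move outward: the shifted h' to the left past a' k, then k to the
  right past the shifted p'. The supports of k and h' are bounded so that \<open>P_sub_conj\<close>
  applies; h and k' end up outermost anyway.\<close>

lemma star_N_in_double_coset:
  assumes a': "a' \<in> carrier (GL_inf m)" "supported m N a'"
    and p': "p' \<in> carrier (GL_inf m)" "supported m N p'"
    and h: "h \<in> P_sub m" and k: "k \<in> P_sub m" "supported m N k"
    and h': "h' \<in> P_sub m" "supported m N h'" and k': "k' \<in> P_sub m"
  shows "star_N m N (imat_mult (imat_mult h a') k) (imat_mult (imat_mult h' p') k')
    \<in> double_coset m (star_N m N a' p')"
proof -
  let ?r = "relabel (swap0 N)" and ?W = "window m N"
  \<comment> \<open>This is C together with the indices N, ..., 2 N - 1 of L and R.\<close>
  let ?V = "idx_map (swap0 N) -` ?W"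
  have disj: "?W \<inter> ?V \<subseteq> C_set m" "?V \<inter> ?W \<subseteq> C_set m"
    by (auto simp: window_def range_swap_def C_set_def split: if_splits)
  note f = finite_involution_swap0[of N]
  note c = a'(1) p'(1) P_sub_carrier[OF h] P_sub_carrier[OF k(1)] P_sub_carrier[OF h'(1)]
    P_sub_carrier[OF k']
  define x where "x = imat_mult a' k"
  have x: "x \<in> carrier (GL_inf m)" unfolding x_def using c by (simp add: carrier_mult)
  have x': "supported_on m ?W x"
    unfolding x_def using a' k c by (simp add: supported_iff supported_on_mult carrier_matrices)
  obtain y where y: "y \<in> carrier (GL_inf m)" "imat_mult x y = unit_imat m"
      "imat_mult y x = unit_imat m" "supported_on m ?W y"
    using carrier_inverse[OF x] x' by metis
  \<comment> \<open>Chosen so that u x is x times the shifted h'; the factor k inside x is dealt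
    with afterwards by v.\<close>
  define u where "u = imat_mult (imat_mult x (?r h')) y"
  have u: "u \<in> P_sub m"
    unfolding u_def
    using h' P_sub_conj[OF x x' y(1,4,2) relabel_P_sub[OF _ f] relabel_supported_on[OF _ f] disj(1)]
    by (simp add: supported_iff)
  have r: "?r g \<in> carrier (GL_inf m)" if "g \<in> carrier (GL_inf m)" for g :: "'a imat"
    using that f by (rule relabel_carrier)
  have ux: "imat_mult u x = imat_mult x (?r h')"
    unfolding u_def using x y r c
    by (simp add: carrier_assoc[of _ m] carrier_mult imat_mult_unit_right carrier_matrices)
  define q where "q = ?r p'"
  have q: "q \<in> carrier (GL_inf m)" "supported_on m ?V q"
    unfolding q_def using r p' relabel_supported_on[OF _ f] by (auto simp: supported_iff)
  obtain z where z: "z \<in> carrier (GL_inf m)" "imat_mult q z = unit_imat m"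
      "imat_mult z q = unit_imat m" "supported_on m ?V z"
    using carrier_inverse[OF q(1)] q(2) by metis
  \<comment> \<open>Here the inverse z stands on the left, so that k q = q v.\<close>
  define v where "v = imat_mult (imat_mult z k) q"
  have v: "v \<in> P_sub m"
    unfolding v_def
    using k P_sub_conj[OF z(1,4) q z(3) k(1) _ disj(2)] by (simp add: supported_iff)
  have qv: "imat_mult q v = imat_mult k q"
    unfolding v_def using z q c
    by (simp add: carrier_assoc[of _ m, symmetric] carrier_mult imat_mult_unit_left carrier_matrices)
  note cc = c x y(1) q(1) z(1) P_sub_carrier[OF u] P_sub_carrier[OF v]
    r[OF c(5)] r[OF c(6)]
  have "star_N m N (imat_mult (imat_mult h a') k) (imat_mult (imat_mult h' p') k')
      = imat_mult (imat_mult h x) (imat_mult (imat_mult (?r h') q) (?r k'))"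
    unfolding x_def q_def using cc f
    by (simp add: star_N_eq relabel_mult[of _ m] carrier_mult carrier_assoc[of _ m])
  also have "\<dots> = imat_mult h (imat_mult (imat_mult x (?r h')) (imat_mult q (?r k')))"
    using cc by (simp add: carrier_mult carrier_assoc[of _ m])
  also have "\<dots> = imat_mult (imat_mult h u) (imat_mult a' (imat_mult (imat_mult k q) (?r k')))"
    unfolding ux[symmetric] unfolding x_def using cc by (simp add: carrier_mult carrier_assoc[of _ m])
  also have "\<dots> = imat_mult (imat_mult (imat_mult h u) (star_N m N a' p')) (imat_mult v (?r k'))"
    unfolding qv[symmetric] using cc f
    by (simp add: star_N_eq carrier_mult carrier_assoc[of _ m] q_def)
  also have "\<dots> \<in> double_coset m (star_N m N a' p')"
    using h u v k' f by (intro double_cosetI P_sub_mult relabel_P_sub)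
  finally show ?thesis .
qed

text \<open>Both products are moved to a common large window that also supports the inner factors
  linking the representatives. The converse membership follows by exchanging the two sides.\<close>

lemma star_N_double_coset_subset:
  assumes a: "a \<in> carrier (GL_inf m)" "supported m N a"
    and p: "p \<in> carrier (GL_inf m)" "supported m N p"
    and a': "a' \<in> carrier (GL_inf m)" "supported m N' a'"
    and p': "p' \<in> carrier (GL_inf m)" "supported m N' p'"
    and dc: "double_coset m a = double_coset m a'" "double_coset m p = double_coset m p'"
  shows "star_N m N a p \<in> double_coset m (star_N m N' a' p')"
proof -
  obtain h k where hk: "h \<in> P_sub m" "k \<in> P_sub m" "a = imat_mult (imat_mult h a') k"
    using double_coset_self[OF a(1)] unfolding dc by (auto simp: double_coset_eq)
  obtain h' k' where hk': "h' \<in> P_sub m" "k' \<in> P_sub m" "p = imat_mult (imat_mult h' p') k'"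
    using double_coset_self[OF p(1)] unfolding dc by (auto simp: double_coset_eq)
  obtain K K' where K: "supported m K k" "supported m K' h'"
    using hk hk' P_sub_carrier carrier_supported by metis
  \<comment> \<open>2 N and 2 N' serve \<open>star_N_far\<close>; K and K' cover the inner
    factors.\<close>
  define M where "M = 2 * N + 2 * N' + K + K'"
  have "supported m M k" "supported m M h'" "supported m M a'" "supported m M p'"
    using K a'(2) p'(2) by (auto simp: M_def elim: supported_mono)
  then have "star_N m M a p \<in> double_coset m (star_N m M a' p')"
    unfolding hk(3) hk'(3) using hk hk' a' p' by (intro star_N_in_double_coset)
  moreover have "double_coset m (star_N m N a p) = double_coset m (star_N m M a p)"
    using a p by (intro star_N_far) (auto simp: M_def)
  moreover have "double_coset m (star_N m N' a' p') = double_coset m (star_N m M a' p')"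
    using a' p' by (intro star_N_far) (auto simp: M_def)
  ultimately show ?thesis
    using double_coset_self[OF star_N_carrier[OF a(1) p(1)], of N]
      double_coset_trans[OF _ _ star_N_carrier[OF a'(1) p'(1)]]
    by metis
qed

lemma star_N_well_defined:
  assumes "a \<in> carrier (GL_inf m)" "supported m N a"
    and "p \<in> carrier (GL_inf m)" "supported m N p"
    and "a' \<in> carrier (GL_inf m)" "supported m N' a'"
    and "p' \<in> carrier (GL_inf m)" "supported m N' p'"
    and "double_coset m a = double_coset m a'" "double_coset m p = double_coset m p'"
  shows "double_coset m (star_N m N a p) = double_coset m (star_N m N' a' p')"
proof (rule double_coset_eqI)
  show "star_N m N a p \<in> double_coset m (star_N m N' a' p')"
    using assms by (intro star_N_double_coset_subset)
  show "star_N m N' a' p' \<in> double_coset m (star_N m N a p)"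
    using assms(9,10)[symmetric] assms by (intro star_N_double_coset_subset)
qed (simp_all add: star_N_carrier assms(1,3,5,7))

text \<open>The given representatives witness existence, and \<open>star_N_well_defined\<close>
  identifies every other candidate.\<close>

lemma star_double_coset:
  assumes "a \<in> carrier (GL_inf m)" "supported m N a"
    and "p \<in> carrier (GL_inf m)" "supported m N p"
  shows "star m (double_coset m a) (double_coset m p) = double_coset m (star_N m N a p)"
  unfolding star_def
proof (rule the_equality)
  show "\<exists>a'\<in>carrier (GL_inf m). \<exists>p'\<in>carrier (GL_inf m). \<exists>N'.
     supported m N' a' \<and> supported m N' p' \<and>
     double_coset m a = double_coset m a' \<and> double_coset m p = double_coset m p' \<and>
     double_coset m (star_N m N a p) = double_coset m (star_N m N' a' p')"
    using assms by blast
next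
  fix Z
  assume "\<exists>a'\<in>carrier (GL_inf m). \<exists>p'\<in>carrier (GL_inf m). \<exists>N'.
     supported m N' a' \<and> supported m N' p' \<and>
     double_coset m a = double_coset m a' \<and> double_coset m p = double_coset m p' \<and>
     Z = double_coset m (star_N m N' a' p')"
  then obtain a' p' N' where "a' \<in> carrier (GL_inf m)" "supported m N' a'"
      "p' \<in> carrier (GL_inf m)" "supported m N' p'"
      "double_coset m a = double_coset m a'" "double_coset m p = double_coset m p'"
      and Z: "Z = double_coset m (star_N m N' a' p')"
    by blast
  with assms show "Z = double_coset m (star_N m N a p)"
    unfolding Z by (intro star_N_well_defined[symmetric])
qed

section \<open>Associativity and closure\<close>

text \<open>On the left, \<open>a\<close>, \<open>p\<close>, \<open>q\<close> occupy the blocks starting at \<open>0\<close>, \<open>N\<close>, \<open>3 N\<close>; on the right,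
  those starting at \<open>0\<close>, \<open>2 N\<close>, \<open>3 N\<close>. The two levels are chosen so that a single swap suffices.\<close>

lemma star_N_assoc:
  assumes a: "a \<in> carrier (GL_inf m)" "supported m N a"
    and p: "p \<in> carrier (GL_inf m)" "supported m N p"
    and q: "q \<in> carrier (GL_inf m)" "supported m N q"
  shows "double_coset m (star_N m (3 * N) (star_N m N a p) q)
    = double_coset m (star_N m (2 * N) a (star_N m N p q))" (is "double_coset m ?x = double_coset m ?y")
proof -
  \<comment> \<open>Exchanges the second and third blocks of length N, which moves p and leaves a
    and q in place.\<close>
  let ?f = "range_swap N N (2 * N)"
  have f: "finite_involution ?f" by (intro finite_involution_range_swap) auto
  note inj = finite_involution_inj[OF f] finite_involution_inj[OF finite_involution_swap0]
  have a': "relabel ?f a = a"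
    by (rule relabel_fixes[OF a(2) f]) (auto simp: range_swap_def)
  have p': "relabel ?f (relabel (swap0 N) p) = relabel (swap0 (2 * N)) p"
    unfolding relabel_comp
    by (rule relabel_cong[OF p(2)])
      (auto simp: range_swap_def inj intro!: inj_compose split: if_splits)
  \<comment> \<open>Both compositions send k to k - 3 N for 3 N <= k < 4 N and take no other k below
    N.\<close>
  have q': "relabel ?f (relabel (swap0 (3 * N)) q) = relabel (swap0 (2 * N)) (relabel (swap0 N) q)"
    unfolding relabel_comp
    by (rule relabel_cong[OF q(2)])
      (auto simp: range_swap_def inj intro!: inj_compose split: if_splits)
  note c = a(1) p(1) q(1)
  have eq: "relabel ?f ?x = ?y"
    using c f a' p' q'
    by (simp add: star_N_eq star_N_carrier relabel_mult[of _ m] relabel_carrier carrier_mult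
        carrier_assoc[of _ m] finite_involution_swap0)
  have "?x \<in> carrier (GL_inf m)" using c by (simp add: star_N_carrier)
  then show ?thesis using double_coset_relabel[OF _ f, of ?x m] by (simp add: eq)
qed

text \<open>With one window N for all three factors, the inner products are supported at 2 N, so the
  outer ones may be formed at the levels of \<open>star_N_assoc\<close>.\<close>

lemma star_assoc:
  assumes c: "a \<in> carrier (GL_inf m)" "p \<in> carrier (GL_inf m)" "q \<in> carrier (GL_inf m)"
  shows "star m (star m (double_coset m a) (double_coset m p)) (double_coset m q)
    = star m (double_coset m a) (star m (double_coset m p) (double_coset m q))"
proof -
  obtain A B C where "supported m A a" "supported m B p" "supported m C q"
    using c carrier_supported by metis
  then obtain N where N: "supported m N a" "supported m N p" "supported m N q"
    using supported_mono[of m A a "A + B + C"] supported_mono[of m B p "A + B + C"]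
      supported_mono[of m C q "A + B + C"] by simp
  have "supported m (3 * N) q" "supported m (2 * N) a"
    using N supported_mono[of m N q "3 * N"] supported_mono[of m N a "2 * N"] by simp_all
  moreover have "supported m (3 * N) (star_N m N a p)" "supported m (2 * N) (star_N m N p q)"
    using N c by (auto intro!: supported_star_N)
  ultimately show ?thesis
    using N c star_N_assoc[of a m N p q]
    by (simp add: star_double_coset[of _ m N] star_double_coset[of _ m "2 * N"]
        star_double_coset[of _ m "3 * N"] star_N_carrier)
qed

lemma star_closed:
  assumes c: "a \<in> carrier (GL_inf m)" "p \<in> carrier (GL_inf m)"
  shows "star m (double_coset m a) (double_coset m p) \<in> double_cosets m"
proof -
  obtain A B where "supported m A a" "supported m B p"
    using c carrier_supported by metis
  then have "supported m (A + B) a" "supported m (A + B) p"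
    using supported_mono[of m A a "A + B"] supported_mono[of m B p "A + B"] by simp_all
  then have "star m (double_coset m a) (double_coset m p) = double_coset m (star_N m (A + B) a p)"
    using c by (intro star_double_coset)
  then show ?thesis
    using star_N_carrier[OF c, of "A + B"] by (simp add: double_cosets_def)
qed

text \<open>The first conjunct justifies the definite description in \<open>star\<close> and the
  second evaluates it, so that closure and associativity speak of the intended product.\<close>

theorem theorem1p4:
  fixes m :: nat
  shows
    "(\<forall>a \<in> carrier (GL_inf m :: 'k::field imat monoid). \<forall>a' \<in> carrier (GL_inf m).
      \<forall>p \<in> carrier (GL_inf m). \<forall>p' \<in> carrier (GL_inf m). \<forall>N N'.
        supported m N a \<longrightarrow> supported m N p \<longrightarrow>
        supported m N' a' \<longrightarrow> supported m N' p' \<longrightarrow>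
        double_coset m a = double_coset m a' \<longrightarrow>
        double_coset m p = double_coset m p' \<longrightarrow>
        double_coset m (star_N m N a p) = double_coset m (star_N m N' a' p'))
     \<and> (\<forall>a \<in> carrier (GL_inf m :: 'k imat monoid). \<forall>p \<in> carrier (GL_inf m). \<forall>N.
        supported m N a \<longrightarrow> supported m N p \<longrightarrow>
        star m (double_coset m a) (double_coset m p) = double_coset m (star_N m N a p))
     \<and> (\<forall>X \<in> (double_cosets m :: 'k imat set set). \<forall>Y \<in> double_cosets m.
        star m X Y \<in> double_cosets m)
     \<and> (\<forall>X \<in> (double_cosets m :: 'k imat set set). \<forall>Y \<in> double_cosets m.
        \<forall>Z \<in> double_cosets m.
        star m (star m X Y) Z = star m X (star m Y Z))"
proof (intro conjI ballI)
  fix X Y Z :: "'k imat set"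
  assume "X \<in> double_cosets m" "Y \<in> double_cosets m" "Z \<in> double_cosets m"
  then show "star m (star m X Y) Z = star m X (star m Y Z)"
    using star_assoc unfolding double_cosets_def by blast
next
  fix X Y :: "'k imat set"
  assume "X \<in> double_cosets m" "Y \<in> double_cosets m"
  then show "star m X Y \<in> double_cosets m"
    using star_closed unfolding double_cosets_def by blast
qed (use star_N_well_defined star_double_coset in blast)+

end
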